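(* Let $A$ be a finite nonempty set, $m\ge1$, let $\rho\subseteq A^m$ be a generalized quasiorder and $\psi$ an equivalence relation on $A$. Then: (a) $\psi\subseteq\rho^{[2]}$ if and only if $\rho/[\psi]$ is a generalized quasiorder on $A/\psi$. (b) $\psi\subseteq\rho^{\langle2\rangle}$ if and only if ($\rho/\psi$ is a generalized quasiorder on $A/\psi$ and $\rho/\psi=\rho/[\psi]$). (c) $(\rho/[\rho^{[2]}])^{[2]}=\Delta_{A/\rho^{[2]}}$, $\ \mathrm{abs}(\rho/\rho^{[2]})=\Delta^{(m)}_{A/\rho^{[2]}}$, and $(\rho/\rho^{\langle2\rangle})^{\langle2\rangle}=\Delta_{A/\rho^{\langle2\rangle}}$.
   Context: For any finite nonempty set $X$, a relation $\rho\subseteq X^m$ is reflexive if $(a,\dots,a)\in\rho$ for all $a\in X$; it is (generalized) transitive if for every matrix $(a_{ij})\in X^{m\times m}$ all of whose rows and all of whose columns belong to $\rho$, the diagonal $(a_{11},\dots,a_{mm})$ belongs to $\rho$. A generalized quasiorder on $X$ is a reflexive and transitive relation. For $\rho\subseteq X^m$: $\rho^{[2]}:=\{(a,b)\in X^2\mid\{a,b\}^m\subseteq\rho\}$; $\mathrm{abs}(\rho):=\{(a_1,\dots,a_m)\mid\{a_1,\dots,a_m\}^m\subseteq\rho\}$; and $\rho^{\langle2\rangle}$ is the set of pairs $(a,b)\in X^2$ that are exchangeable with respect to $\rho$, i.e. such that for every $i\in\{1,\dots,m\}$ and all $a_1,\dots,a_{i-1},a_{i+1},\dots,a_m\in X$: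 $(a_1,\dots,a_{i-1},a,a_{i+1},\dots,a_m)\in\rho\iff(a_1,\dots,a_{i-1},b,a_{i+1},\dots,a_m)\in\rho$. If $\rho$ is a generalized quasiorder then $\rho^{[2]}$ and $\rho^{\langle2\rangle}$ are equivalence relations. $\Delta_X:=\{(a,a)\mid a\in X\}$ and $\Delta_X^{(m)}:=\{(a,\dots,a)\in X^m\mid a\in X\}$. For an equivalence relation $\psi$ on $A$ with set of classes $A/\psi$: the factor relation is $\rho/\psi:=\{([a_1]_\psi,\dots,[a_m]_\psi)\mid(a_1,\dots,a_m)\in\rho\}$ and the block factor relation is $\rho/[\psi]:=\{(B_1,\dots,B_m)\in(A/\psi)^m\mid B_1\times\dots\times B_m\subseteq\rho\}$. *)

theory Defs
  imports Main "HOL-Library.NList"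
begin

text \<open>
  The power \<open>X\<^sup>m\<close> is rendered as \<^term>\<open>nlists m X\<close>, the lists of length \<open>m\<close> over \<open>X\<close>, so an
  \<open>m\<close>-ary relation on \<open>X\<close> is a subset of \<^term>\<open>nlists m X\<close>. Positions are counted from \<open>0\<close>.
\<close>

definition reflexive_rel :: "'a set \<Rightarrow> nat \<Rightarrow> 'a list set \<Rightarrow> bool" where
  "reflexive_rel X m \<rho> \<longleftrightarrow> (\<forall>a\<in>X. replicate m a \<in> \<rho>)"

definition transitive_rel :: "'a set \<Rightarrow> nat \<Rightarrow> 'a list set \<Rightarrow> bool" where
  "transitive_rel X m \<rho> \<longleftrightarrow>
     (\<forall>M :: nat \<Rightarrow> nat \<Rightarrow> 'a.
        (\<forall>i<m. \<forall>j<m. M i j \<in> X) \<longrightarrow>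
        (\<forall>i<m. map (\<lambda>j. M i j) [0..<m] \<in> \<rho>) \<longrightarrow>
        (\<forall>j<m. map (\<lambda>i. M i j) [0..<m] \<in> \<rho>) \<longrightarrow>
        map (\<lambda>i. M i i) [0..<m] \<in> \<rho>)"

definition generalized_quasiorder :: "'a set \<Rightarrow> nat \<Rightarrow> 'a list set \<Rightarrow> bool" where
  "generalized_quasiorder X m \<rho> \<longleftrightarrow>
     \<rho> \<subseteq> nlists m X \<and> reflexive_rel X m \<rho> \<and> transitive_rel X m \<rho>"

text \<open>The relation \<open>\<rho>\<close> with superscript \<open>[2]\<close>.\<close>

definition square_rel :: "'a set \<Rightarrow> nat \<Rightarrow> 'a list set \<Rightarrow> ('a \<times> 'a) set" where
  "square_rel X m \<rho> = {(a, b) \<in> X \<times> X. nlists m {a, b} \<subseteq> \<rho>}"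

definition abs_rel :: "'a set \<Rightarrow> nat \<Rightarrow> 'a list set \<Rightarrow> 'a list set" where
  "abs_rel X m \<rho> = {as \<in> nlists m X. nlists m (set as) \<subseteq> \<rho>}"

text \<open>
  The relation \<open>\<rho>\<close> with superscript \<open>\<langle>2\<rangle>\<close>: the lists \<open>as\<close> and \<open>cs\<close> are the entries before
  and after the exchanged one, which is at position \<open>i\<close>.
\<close>

definition exchangeable_rel :: "'a set \<Rightarrow> nat \<Rightarrow> 'a list set \<Rightarrow> ('a \<times> 'a) set" where
  "exchangeable_rel X m \<rho> =
     {(a, b) \<in> X \<times> X.
        \<forall>i<m. \<forall>as\<in>nlists i X. \<forall>cs\<in>nlists (m - 1 - i) X.
          as @ a # cs \<in> \<rho> \<longleftrightarrow> as @ b # cs \<in> \<rho>}"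

text \<open>The binary diagonal \<open>\<Delta>\<close> is \<^const>\<open>Id_on\<close>; this is the \<open>m\<close>-ary one.\<close>

definition diagonal :: "'a set \<Rightarrow> nat \<Rightarrow> 'a list set" where
  "diagonal X m = {replicate m a | a. a \<in> X}"

text \<open>For an equivalence relation \<open>\<psi>\<close>, the class of \<open>a\<close> is \<open>\<psi> `` {a}\<close>.\<close>

definition factor_rel :: "'a list set \<Rightarrow> ('a \<times> 'a) set \<Rightarrow> 'a set list set" where
  "factor_rel \<rho> \<psi> = {map (\<lambda>a. \<psi> `` {a}) as | as. as \<in> \<rho>}"

text \<open>\<^term>\<open>listset Bs\<close> is the Cartesian product of the sets in the list \<open>Bs\<close>.\<close>

definition block_factor_rel ::
    "'a set \<Rightarrow> nat \<Rightarrow> 'a list set \<Rightarrow> ('a \<times> 'a) set \<Rightarrow> 'a set list set" where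
  "block_factor_rel A m \<rho> \<psi> = {Bs \<in> nlists m (A // \<psi>). listset Bs \<subseteq> \<rho>}"

end

theory Submission
  imports Defs
begin

text \<open>
  The main device is to apply transitivity to symmetric matrices, where only the rows have to be
  checked. A matrix that is constantly \<open>b\<close> off the diagonal shows that \<open>S\<^sup>m \<subseteq> \<rho>\<close> as soon as all tuples
  with at most one entry from \<open>S\<close> and \<open>b\<close> elsewhere are in \<open>\<rho>\<close>; hence \<open>B\<^sup>m \<subseteq> \<rho>\<close> for each class \<open>B\<close> of
  \<open>\<rho>\<^bsup>[2]\<^esup>\<close>, which gives (a) and the first part of (c). For \<open>\<rho>\<^bsup>\<langle>2\<rangle>\<^esup>\<close> the point is that \<open>\<rho>\<close> is
  saturated with respect to it.

  The claim on \<open>abs(\<rho>/\<rho>\<^bsup>[2]\<^esup>)\<close> is more delicate, because a tuple of classes in \<open>\<rho>/\<rho>\<^bsup>[2]\<^esup>\<close> is only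
  known to have one representative in \<open>\<rho>\<close>. For a tuple of classes with a single entry different from \<open>B\<close>, however, two
  further symmetric matrices show that all representatives are in \<open>\<rho>\<close>, and then the first
  construction applies again.
\<close>

text \<open>As simp rules, they loop when \<^term>\<open>nlists\<close> is unfolded in their premises.\<close>

declare nlistsE_length [simp del] nlistsE_set [simp del]

section \<open>Tuples and Cartesian products as lists\<close>

lemma in_listset_iff:
  "xs \<in> listset Bs \<longleftrightarrow> length xs = length Bs \<and> (\<forall>i<length Bs. xs ! i \<in> Bs ! i)"
proof (induction Bs arbitrary: xs)
  case Nil
  show ?case by simp
next
  case (Cons B Bs)
  show ?case
    by (cases xs) (auto simp: set_Cons_def Cons.IH nth_Cons less_Suc_eq_0_disj split: nat.splits)
qed

lemma in_nlists_iff_nth: "xs \<in> nlists m S \<longleftrightarrow> length xs = m \<and> (\<forall>i<m. xs ! i \<in> S)"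
  by (auto simp: nlists_def subset_iff in_set_conv_nth)

lemma map_in_nlists: "(\<And>i. i < m \<Longrightarrow> f i \<in> S) \<Longrightarrow> map f [0..<m] \<in> nlists m S"
  by (auto simp: in_nlists_iff_nth)

section \<open>Transitivity along symmetric matrices\<close>

lemma generalized_quasiorderD:
  assumes "generalized_quasiorder A m \<rho>"
  shows generalized_quasiorder_subset: "\<rho> \<subseteq> nlists m A"
    and generalized_quasiorder_replicate: "a \<in> A \<Longrightarrow> replicate m a \<in> \<rho>"
  using assms by (auto simp: generalized_quasiorder_def reflexive_rel_def)

text \<open>By symmetry each column is also a row, and the entries lie in \<open>A\<close> because
  the rows belong to \<open>\<rho>\<close>.\<close>

lemma generalized_quasiorder_diag:
  assumes gq: "generalized_quasiorder A m \<rho>"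
    and sym: "\<And>i j. M i j = M j i"
    and rows: "\<And>i. i < m \<Longrightarrow> map (M i) [0..<m] \<in> \<rho>"
  shows "map (\<lambda>i. M i i) [0..<m] \<in> \<rho>"
proof -
  have "M i j \<in> A" if "i < m" "j < m" for i j
    using rows[OF \<open>i < m\<close>] that generalized_quasiorder_subset[OF gq]
    by (auto simp: in_nlists_iff_nth)
  moreover have "map (\<lambda>i. M i j) [0..<m] \<in> \<rho>" if "j < m" for j
    using rows[OF that] by (simp add: sym[of _ j])
  ultimately show ?thesis
    using gq rows unfolding generalized_quasiorder_def transitive_rel_def by blast
qed

lemma nlists_subset_of_single_entries:
  assumes gq: "generalized_quasiorder A m \<rho>"
    and single: "\<And>x i. x \<in> S \<Longrightarrow> i < m \<Longrightarrow> map (\<lambda>j. if j = i then x else b) [0..<m] \<in> \<rho>"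
  shows "nlists m S \<subseteq> \<rho>"
proof
  fix xs assume xs: "xs \<in> nlists m S"
  \<comment> \<open>The diagonal is \<open>xs\<close>; row \<open>i\<close> has
    \<open>xs ! i\<close> at position \<open>i\<close> and \<open>b\<close> elsewhere, as in
    \<open>single\<close>.\<close>
  define M where "M = (\<lambda>i j. if j = i then xs ! i else b)"
  have "map (\<lambda>i. M i i) [0..<m] \<in> \<rho>"
  proof (rule generalized_quasiorder_diag[OF gq, where M = M])
    show "M i j = M j i" for i j by (simp add: M_def)
    show "map (M i) [0..<m] \<in> \<rho>" if "i < m" for i
      using single[OF _ that, of "xs ! i"] xs that by (simp add: M_def in_nlists_iff_nth cong: if_cong)
  qed
  moreover have "map (\<lambda>i. M i i) [0..<m] = xs"
    using xs by (auto simp: M_def in_nlists_iff_nth intro: nth_equalityI)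
  ultimately show "xs \<in> \<rho>" by simp
qed

text \<open>A tuple with one entry \<open>x\<close> and \<open>b\<close> elsewhere lies in
  \<open>nlists m {b, x}\<close>, hence in \<open>\<rho>\<close>. Later \<open>b\<close> is the
  middle element in the transitivity of \<open>square_rel\<close>, or a representative of the class
  \<open>S\<close>.\<close>

lemma nlists_subset_of_square_rel:
  assumes gq: "generalized_quasiorder A m \<rho>"
    and S: "\<And>x. x \<in> S \<Longrightarrow> (b, x) \<in> square_rel A m \<rho>"
  shows "nlists m S \<subseteq> \<rho>"
proof (rule nlists_subset_of_single_entries[OF gq])
  fix x i assume "x \<in> S" "i < m"
  have "map (\<lambda>j. if j = i then x else b) [0..<m] \<in> nlists m {b, x}"
    by (rule map_in_nlists) auto
  then show "map (\<lambda>j. if j = i then x else b) [0..<m] \<in> \<rho>"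
    using S[OF \<open>x \<in> S\<close>] by (auto simp: square_rel_def)
qed

section \<open>The equivalence relations \<open>square_rel\<close> and
  \<open>exchangeable_rel\<close>\<close>

lemma equiv_square_rel:
  assumes gq: "generalized_quasiorder A m \<rho>"
  shows "equiv A (square_rel A m \<rho>)"
proof (rule equivI)
  show "square_rel A m \<rho> \<subseteq> A \<times> A" by (auto simp: square_rel_def)
  show "refl_on A (square_rel A m \<rho>)"
    using generalized_quasiorder_replicate[OF gq]
    by (auto simp: refl_on_def square_rel_def nlists_singleton)
  show sym: "sym (square_rel A m \<rho>)"
    by (auto simp: sym_def square_rel_def insert_commute)
  show "trans (square_rel A m \<rho>)"
  proof (rule transI)
    fix a b c assume ab: "(a, b) \<in> square_rel A m \<rho>" and bc: "(b, c) \<in> square_rel A m \<rho>"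
    \<comment> \<open>The middle element \<open>b\<close> serves as base point for the set
      \<open>{a, c}\<close>.\<close>
    have "nlists m {a, c} \<subseteq> \<rho>"
      using symD[OF sym ab] bc by (intro nlists_subset_of_square_rel[OF gq, of _ b]) auto
    then show "(a, c) \<in> square_rel A m \<rho>"
      using ab bc by (auto simp: square_rel_def)
  qed
qed

lemma equiv_exchangeable_rel: "equiv A (exchangeable_rel A m \<rho>)"
  by (rule equivI) (auto simp: exchangeable_rel_def refl_on_def sym_def trans_def)

text \<open>The entries are exchanged one at a time from left to right, and no exchange affects
  membership in \<open>\<rho>\<close>.\<close>

lemma exchangeable_rel_saturated:
  assumes "list_all2 (\<lambda>x y. (x, y) \<in> exchangeable_rel A m \<rho>) xs ys" and "length xs = m"
  shows "xs \<in> \<rho> \<longleftrightarrow> ys \<in> \<rho>"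
proof -
  \<comment> \<open>The prefix \<open>ps\<close> holds the entries already exchanged. It is carried
    along because exchangeability speaks of full tuples of length \<open>m\<close>.\<close>
  have "ps @ xs \<in> \<rho> \<longleftrightarrow> ps @ ys \<in> \<rho>" if "set ps \<subseteq> A" "length ps + length xs = m" for ps
    using assms(1) that
  proof (induction arbitrary: ps rule: list_all2_induct)
    case Nil
    show ?case by simp
  next
    case (Cons x xs y ys)
    from Cons.hyps(2) have "set xs \<subseteq> A"
      by (induction rule: list_all2_induct) (auto simp: exchangeable_rel_def)
    then have "ps \<in> nlists (length ps) A" "xs \<in> nlists (m - 1 - length ps) A" "length ps < m"
      using Cons.prems by (auto simp: nlists_def)
    then have "ps @ x # xs \<in> \<rho> \<longleftrightarrow> ps @ y # xs \<in> \<rho>"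
      using Cons.hyps(1) unfolding exchangeable_rel_def by blast
    also have "\<dots> \<longleftrightarrow> (ps @ [y]) @ ys \<in> \<rho>"
      using Cons.IH[of "ps @ [y]"] Cons.prems Cons.hyps by (auto simp: exchangeable_rel_def)
    finally show ?case by simp
  qed
  from this[of "[]"] assms(2) show ?thesis by simp
qed

text \<open>The constant tuple of \<open>a\<close> is in \<open>\<rho>\<close> by reflexivity, and
  every tuple over \<open>{a, b}\<close> arises from it by exchanging entries.\<close>

lemma exchangeable_subset_square_rel:
  assumes gq: "generalized_quasiorder A m \<rho>"
  shows "exchangeable_rel A m \<rho> \<subseteq> square_rel A m \<rho>"
proof clarify
  fix a b assume ab: "(a, b) \<in> exchangeable_rel A m \<rho>"
  then have A: "a \<in> A" "b \<in> A" by (auto simp: exchangeable_rel_def)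
  have "xs \<in> \<rho>" if "xs \<in> nlists m {a, b}" for xs
  proof -
    have "list_all2 (\<lambda>x y. (x, y) \<in> exchangeable_rel A m \<rho>) (replicate m a) xs"
      using that ab equiv_class_self[OF equiv_exchangeable_rel A(1), of m \<rho>]
      by (auto simp: list_all2_conv_all_nth in_nlists_iff_nth)
    from exchangeable_rel_saturated[OF this] show ?thesis
      using generalized_quasiorder_replicate[OF gq A(1)] by simp
  qed
  with A show "(a, b) \<in> square_rel A m \<rho>" by (auto simp: square_rel_def)
qed

section \<open>Classes, representatives and factor relations\<close>

text \<open>Turns a product of classes into an entrywise relation between tuples, the form in which
  saturation is applied.\<close>

lemma in_listset_map_class_iff:
  "ys \<in> listset (map (\<lambda>a. \<psi> `` {a}) xs) \<longleftrightarrow> list_all2 (\<lambda>x y. (x, y) \<in> \<psi>) xs ys"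
  by (auto simp: in_listset_iff list_all2_conv_all_nth)

lemma equiv_list_all2_refl:
  assumes "equiv A \<psi>" and "set xs \<subseteq> A"
  shows "list_all2 (\<lambda>x y. (x, y) \<in> \<psi>) xs xs"
  using assms by (auto simp: list_all2_same equiv_def refl_on_def)

lemma map_class_in_factor_rel:
  "xs \<in> \<rho> \<Longrightarrow> map (\<lambda>a. \<psi> `` {a}) xs \<in> factor_rel \<rho> \<psi>"
  by (auto simp: factor_rel_def)

lemma map_class_in_factor_rel_iff:
  assumes eq: "equiv A \<psi>" and xs: "set xs \<subseteq> A" and rho: "\<rho> \<subseteq> nlists m A"
  shows "map (\<lambda>a. \<psi> `` {a}) xs \<in> factor_rel \<rho> \<psi> \<longleftrightarrow>
    (\<exists>ys\<in>\<rho>. set ys \<subseteq> A \<and> list_all2 (\<lambda>x y. (x, y) \<in> \<psi>) xs ys)"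
proof -
  have "map (\<lambda>a. \<psi> `` {a}) xs = map (\<lambda>a. \<psi> `` {a}) ys \<longleftrightarrow> list_all2 (\<lambda>x y. (x, y) \<in> \<psi>) xs ys"
    if "set ys \<subseteq> A" for ys
  proof -
    \<comment> \<open>Equality of lists is read as \<open>list_all2 (=)\<close>, which is then moved
      through both maps.\<close>
    have "map (\<lambda>a. \<psi> `` {a}) xs = map (\<lambda>a. \<psi> `` {a}) ys \<longleftrightarrow>
        list_all2 (\<lambda>x y. \<psi> `` {x} = \<psi> `` {y}) xs ys"
      by (simp add: list_all2_map1 list_all2_map2 flip: list.rel_eq)
    also have "\<dots> \<longleftrightarrow> list_all2 (\<lambda>x y. (x, y) \<in> \<psi>) xs ys"
      using xs that eq_equiv_class_iff[OF eq] by (intro list.rel_cong refl) blast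
    finally show ?thesis .
  qed
  moreover have "set ys \<subseteq> A" if "ys \<in> \<rho>" for ys
    using rho that by (auto simp: nlists_def)
  ultimately show ?thesis
    unfolding factor_rel_def by blast
qed

lemma nlists_quotientE:
  assumes "Bs \<in> nlists m (A // \<psi>)"
  obtains xs where "xs \<in> nlists m A" and "Bs = map (\<lambda>a. \<psi> `` {a}) xs"
proof -
  have "\<forall>B\<in>A // \<psi>. \<exists>a\<in>A. B = \<psi> `` {a}" by (auto elim: quotientE)
  then obtain r where "\<And>B. B \<in> A // \<psi> \<Longrightarrow> r B \<in> A \<and> B = \<psi> `` {r B}" by metis
  with assms have "map r Bs \<in> nlists m A" "Bs = map (\<lambda>a. \<psi> `` {a}) (map r Bs)"
    by (auto simp: nlists_def subset_iff intro!: map_idI[symmetric])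
  then show ?thesis by (rule that)
qed

lemma map_class_in_nlists_quotient:
  "xs \<in> nlists m A \<Longrightarrow> map (\<lambda>a. \<psi> `` {a}) xs \<in> nlists m (A // \<psi>)"
  by (auto simp: nlists_def intro: quotientI)

text \<open>Since \<open>\<psi>\<close> is reflexive, a tuple of representatives lies in the product
  of its own classes, and this product is contained in \<open>\<rho>\<close>.\<close>

lemma block_factor_rel_subset_factor_rel:
  assumes eq: "equiv A \<psi>"
  shows "block_factor_rel A m \<rho> \<psi> \<subseteq> factor_rel \<rho> \<psi>"
proof
  fix Bs assume Bs: "Bs \<in> block_factor_rel A m \<rho> \<psi>"
  then obtain xs where xs: "xs \<in> nlists m A" "Bs = map (\<lambda>a. \<psi> `` {a}) xs"
    by (auto simp: block_factor_rel_def elim: nlists_quotientE)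
  with Bs equiv_list_all2_refl[OF eq] have "xs \<in> \<rho>"
    by (auto simp: block_factor_rel_def in_listset_map_class_iff nlists_def)
  with xs show "Bs \<in> factor_rel \<rho> \<psi>" by (simp add: map_class_in_factor_rel)
qed

lemma listset_replicate: "listset (replicate m B) = nlists m B"
  by (auto simp: in_listset_iff in_nlists_iff_nth)

section \<open>Block factor relations and \<open>square_rel\<close>\<close>

text \<open>Any representative of \<open>B\<close> can be the base point. The inclusion is what
  reflexivity of the block factor relation amounts to.\<close>

lemma class_nlists_subset:
  assumes gq: "generalized_quasiorder A m \<rho>"
    and sub: "\<psi> \<subseteq> square_rel A m \<rho>" and B: "B \<in> A // \<psi>"
  shows "nlists m B \<subseteq> \<rho>"
proof -
  from B obtain b where "B = \<psi> `` {b}" by (auto elim: quotientE)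
  with sub show ?thesis by (intro nlists_subset_of_square_rel[OF gq, of _ b]) auto
qed

text \<open>For transitivity, a matrix of classes is lifted to a matrix of elements with a
  prescribed diagonal. Conversely, reflexivity puts the \<open>m\<close>-th power of each class into
  \<open>\<rho>\<close>, and with it all tuples over two equivalent elements.\<close>

lemma subset_square_rel_iff:
  assumes gq: "generalized_quasiorder A m \<rho>" and eq: "equiv A \<psi>"
  shows "\<psi> \<subseteq> square_rel A m \<rho> \<longleftrightarrow>
    generalized_quasiorder (A // \<psi>) m (block_factor_rel A m \<rho> \<psi>)"
proof
  assume sub: "\<psi> \<subseteq> square_rel A m \<rho>"
  have "reflexive_rel (A // \<psi>) m (block_factor_rel A m \<rho> \<psi>)"
    using class_nlists_subset[OF gq sub]
    by (auto simp: reflexive_rel_def block_factor_rel_def listset_replicate nlists_def)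
  moreover have "transitive_rel (A // \<psi>) m (block_factor_rel A m \<rho> \<psi>)"
    unfolding transitive_rel_def
  proof (intro allI impI)
    fix N :: "nat \<Rightarrow> nat \<Rightarrow> 'a set"
    assume N: "\<forall>i<m. \<forall>j<m. N i j \<in> A // \<psi>"
      and rows: "\<forall>i<m. map (\<lambda>j. N i j) [0..<m] \<in> block_factor_rel A m \<rho> \<psi>"
      and cols: "\<forall>j<m. map (\<lambda>i. N i j) [0..<m] \<in> block_factor_rel A m \<rho> \<psi>"
    have "xs \<in> \<rho>" if xs: "xs \<in> listset (map (\<lambda>i. N i i) [0..<m])" for xs
    proof -
      \<comment> \<open>The diagonal is the given \<open>xs\<close>. Off the diagonal any
        representatives will do, because the whole product of each row and of each column of classes
        lies in \<open>\<rho>\<close>.\<close>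
      define M where "M = (\<lambda>i j. if i = j then xs ! i else SOME x. x \<in> N i j)"
      have M: "M i j \<in> N i j" if "i < m" "j < m" for i j
        using xs that N in_quotient_imp_non_empty[OF eq, of "N i j"]
        by (auto simp: M_def in_listset_iff some_in_eq)
      then have "map (\<lambda>j. M i j) [0..<m] \<in> listset (map (\<lambda>j. N i j) [0..<m])"
        and "map (\<lambda>j. M j i) [0..<m] \<in> listset (map (\<lambda>j. N j i) [0..<m])" if "i < m" for i
        using that by (auto simp: in_listset_iff)
      moreover have "listset (map (\<lambda>j. N i j) [0..<m]) \<subseteq> \<rho>" "listset (map (\<lambda>j. N j i) [0..<m]) \<subseteq> \<rho>"
        if "i < m" for i
        using that rows cols by (auto simp: block_factor_rel_def)
      ultimately have "\<forall>i<m. map (\<lambda>j. M i j) [0..<m] \<in> \<rho>" "\<forall>i<m. map (\<lambda>j. M j i) [0..<m] \<in> \<rho>"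
        by (meson subsetD)+
      moreover have "\<forall>i<m. \<forall>j<m. M i j \<in> A"
        using M N in_quotient_imp_subset[OF eq] by blast
      ultimately have "map (\<lambda>i. M i i) [0..<m] \<in> \<rho>"
        using gq unfolding generalized_quasiorder_def transitive_rel_def by blast
      moreover have "map (\<lambda>i. M i i) [0..<m] = xs"
        using xs by (auto simp: M_def in_listset_iff intro: nth_equalityI)
      ultimately show ?thesis by simp
    qed
    with N show "map (\<lambda>i. N i i) [0..<m] \<in> block_factor_rel A m \<rho> \<psi>"
      by (auto simp: block_factor_rel_def intro: map_in_nlists)
  qed
  ultimately show "generalized_quasiorder (A // \<psi>) m (block_factor_rel A m \<rho> \<psi>)"
    by (auto simp: generalized_quasiorder_def block_factor_rel_def)
next
  assume gq': "generalized_quasiorder (A // \<psi>) m (block_factor_rel A m \<rho> \<psi>)"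
  show "\<psi> \<subseteq> square_rel A m \<rho>"
  proof clarify
    fix a b assume ab: "(a, b) \<in> \<psi>"
    then have A: "a \<in> A" "b \<in> A" using eq by (auto simp: equiv_def)
    have "nlists m (\<psi> `` {a}) \<subseteq> \<rho>"
      using generalized_quasiorder_replicate[OF gq' quotientI[OF A(1)]]
      by (simp add: block_factor_rel_def listset_replicate)
    moreover have "{a, b} \<subseteq> \<psi> `` {a}"
      using ab equiv_class_self[OF eq A(1)] by auto
    ultimately have "nlists m {a, b} \<subseteq> \<rho>" by (meson nlists_mono order_trans)
    with A show "(a, b) \<in> square_rel A m \<rho>" by (simp add: square_rel_def)
  qed
qed

section \<open>Factor relations and \<open>exchangeable_rel\<close>\<close>

text \<open>The tuple of classes has some representative in \<open>\<rho>\<close>; it differs from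
  \<open>xs\<close> only by exchangeable entries, so saturation applies.\<close>

lemma map_class_in_factor_rel_exchangeable_iff:
  assumes rho: "\<rho> \<subseteq> nlists m A" and eq: "equiv A \<psi>"
    and sub: "\<psi> \<subseteq> exchangeable_rel A m \<rho>" and xs: "xs \<in> nlists m A"
  shows "map (\<lambda>a. \<psi> `` {a}) xs \<in> factor_rel \<rho> \<psi> \<longleftrightarrow> xs \<in> \<rho>"
proof
  assume "map (\<lambda>a. \<psi> `` {a}) xs \<in> factor_rel \<rho> \<psi>"
  with xs obtain ys where "ys \<in> \<rho>" "list_all2 (\<lambda>x y. (x, y) \<in> \<psi>) xs ys"
    using map_class_in_factor_rel_iff[OF eq _ rho] by (auto simp: nlists_def)
  moreover from this(2) have "list_all2 (\<lambda>x y. (x, y) \<in> exchangeable_rel A m \<rho>) xs ys"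
    using sub by (auto elim: list_all2_mono)
  ultimately show "xs \<in> \<rho>"
    using exchangeable_rel_saturated xs by (metis nlistsE_length)
qed (rule map_class_in_factor_rel)

text \<open>By saturation, one representative in \<open>\<rho>\<close> brings the whole product of
  classes into \<open>\<rho>\<close>, so the two factor relations agree, and the criterion for
  \<open>square_rel\<close> yields the quasiorder. Conversely, their equality lets single entries be
  replaced by equivalent ones.\<close>

lemma subset_exchangeable_rel_iff:
  assumes gq: "generalized_quasiorder A m \<rho>" and eq: "equiv A \<psi>"
  shows "\<psi> \<subseteq> exchangeable_rel A m \<rho> \<longleftrightarrow>
    generalized_quasiorder (A // \<psi>) m (factor_rel \<rho> \<psi>) \<and>
    factor_rel \<rho> \<psi> = block_factor_rel A m \<rho> \<psi>"
proof
  assume sub: "\<psi> \<subseteq> exchangeable_rel A m \<rho>"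
  note rho = generalized_quasiorder_subset[OF gq]
  have "Bs \<in> block_factor_rel A m \<rho> \<psi>" if "Bs \<in> factor_rel \<rho> \<psi>" for Bs
  proof -
    from that obtain xs where xs: "xs \<in> \<rho>" "Bs = map (\<lambda>a. \<psi> `` {a}) xs"
      by (auto simp: factor_rel_def)
    have "ys \<in> \<rho>" if "list_all2 (\<lambda>x y. (x, y) \<in> \<psi>) xs ys" for ys
    proof -
      from that have "list_all2 (\<lambda>x y. (x, y) \<in> exchangeable_rel A m \<rho>) xs ys"
        using sub by (auto elim: list_all2_mono)
      then show ?thesis
        using exchangeable_rel_saturated xs rho by (metis nlistsE_length subsetD)
    qed
    with xs rho show ?thesis
      by (auto simp: block_factor_rel_def in_listset_map_class_iff
          intro: map_class_in_nlists_quotient)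
  qed
  then have "factor_rel \<rho> \<psi> = block_factor_rel A m \<rho> \<psi>"
    using block_factor_rel_subset_factor_rel[OF eq] by blast
  with sub show "generalized_quasiorder (A // \<psi>) m (factor_rel \<rho> \<psi>) \<and>
      factor_rel \<rho> \<psi> = block_factor_rel A m \<rho> \<psi>"
    using subset_square_rel_iff[OF gq eq] exchangeable_subset_square_rel[OF gq] by auto
next
  assume "generalized_quasiorder (A // \<psi>) m (factor_rel \<rho> \<psi>) \<and>
    factor_rel \<rho> \<psi> = block_factor_rel A m \<rho> \<psi>"
  then have fb: "factor_rel \<rho> \<psi> = block_factor_rel A m \<rho> \<psi>" by simp
  \<comment> \<open>One direction is enough, since \<open>\<psi>\<close> is symmetric.\<close>
  have *: "as @ b # cs \<in> \<rho>"
    if "(a, b) \<in> \<psi>" "set as \<subseteq> A" "set cs \<subseteq> A" "as @ a # cs \<in> \<rho>" for a b as cs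
  proof -
    have "map (\<lambda>a. \<psi> `` {a}) (as @ a # cs) \<in> block_factor_rel A m \<rho> \<psi>"
      using map_class_in_factor_rel[OF that(4), of \<psi>] fb by simp
    moreover have "list_all2 (\<lambda>x y. (x, y) \<in> \<psi>) (as @ a # cs) (as @ b # cs)"
      using that equiv_list_all2_refl[OF eq] by (auto intro: list_all2_appendI)
    ultimately show ?thesis
      unfolding block_factor_rel_def in_listset_map_class_iff[symmetric] by blast
  qed
  show "\<psi> \<subseteq> exchangeable_rel A m \<rho>"
  proof clarify
    fix a b assume ab: "(a, b) \<in> \<psi>"
    then have "(b, a) \<in> \<psi>" "a \<in> A" "b \<in> A" using eq by (auto simp: equiv_def sym_def)
    with ab * show "(a, b) \<in> exchangeable_rel A m \<rho>"
      by (auto simp: exchangeable_rel_def nlists_def)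
  qed
qed

section \<open>The constructions repeated on the quotient\<close>

text \<open>A tuple over representatives \<open>b\<close>, \<open>c\<close> lies in the product of
  its own classes, which is a subset of \<open>\<rho>\<close>; hence \<open>b\<close> and
  \<open>c\<close> are already equivalent.\<close>

lemma square_rel_block_factor_rel:
  assumes gq: "generalized_quasiorder A m \<rho>"
  defines "\<psi> \<equiv> square_rel A m \<rho>"
  shows "square_rel (A // \<psi>) m (block_factor_rel A m \<rho> \<psi>) = Id_on (A // \<psi>)"
proof -
  have eq: "equiv A \<psi>" unfolding \<psi>_def by (rule equiv_square_rel[OF gq])
  have "B = C" if "(B, C) \<in> square_rel (A // \<psi>) m (block_factor_rel A m \<rho> \<psi>)" for B C
  proof -
    from that have BC: "B \<in> A // \<psi>" "C \<in> A // \<psi>"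
      "nlists m {B, C} \<subseteq> block_factor_rel A m \<rho> \<psi>"
      by (auto simp: square_rel_def)
    from BC(1,2) obtain b c where bc: "b \<in> A" "B = \<psi> `` {b}" "c \<in> A" "C = \<psi> `` {c}"
      by (auto elim!: quotientE)
    have "xs \<in> \<rho>" if xs: "xs \<in> nlists m {b, c}" for xs
    proof -
      have "map (\<lambda>a. \<psi> `` {a}) xs \<in> nlists m {B, C}"
        using xs bc by (auto simp: nlists_def)
      with BC(3) have "listset (map (\<lambda>a. \<psi> `` {a}) xs) \<subseteq> \<rho>"
        by (auto simp: block_factor_rel_def)
      moreover have "set xs \<subseteq> A" using xs bc by (auto simp: nlists_def)
      ultimately show ?thesis
        using equiv_list_all2_refl[OF eq] in_listset_map_class_iff by blast
    qed
    with bc have "(b, c) \<in> \<psi>" by (auto simp: \<psi>_def square_rel_def)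
    with bc show ?thesis using equiv_class_eq[OF eq] by simp
  qed
  moreover have "(B, B) \<in> square_rel (A // \<psi>) m (block_factor_rel A m \<rho> \<psi>)"
    if "B \<in> A // \<psi>" for B
  proof -
    have "replicate m B \<in> block_factor_rel A m \<rho> \<psi>"
      using that class_nlists_subset[OF gq _ that]
      by (auto simp: block_factor_rel_def listset_replicate \<psi>_def in_nlists_iff_nth)
    with that show ?thesis by (simp add: square_rel_def[of "A // \<psi>"] nlists_singleton)
  qed
  moreover have "square_rel (A // \<psi>) m (block_factor_rel A m \<rho> \<psi>) \<subseteq> (A // \<psi>) \<times> (A // \<psi>)"
    by (auto simp: square_rel_def[of "A // \<psi>"])
  ultimately show ?thesis by fast
qed

text \<open>By the single-entry criterion it is enough to have all tuples with one entry from
  \<open>C\<close> and \<open>b\<close> elsewhere in \<open>\<rho>\<close>. This is shown first for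
  one element \<open>c'\<close> of \<open>C\<close>, then for every \<open>x\<close> in
  \<open>C\<close>.\<close>

lemma classes_eq_of_factor_rel:
  assumes gq: "generalized_quasiorder A m \<rho>"
  defines "\<psi> \<equiv> square_rel A m \<rho>"
  assumes B: "B \<in> A // \<psi>" and C: "C \<in> A // \<psi>" and BC: "nlists m {B, C} \<subseteq> factor_rel \<rho> \<psi>"
  shows "B = C"
proof -
  have eq: "equiv A \<psi>" unfolding \<psi>_def by (rule equiv_square_rel[OF gq])
  \<comment> \<open>Every class \<open>D\<close> of \<open>\<psi>\<close> satisfies
    \<open>nlists m D \<subseteq> \<rho>\<close>; the inclusion needed for this is the definition of
    \<open>\<psi>\<close> read as \<open>\<subseteq>\<close>.\<close>
  note clique = class_nlists_subset[OF gq eq_refl[OF \<psi>_def[THEN meta_eq_to_obj_eq]]]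
  from B C obtain b c where bc: "b \<in> A" "B = \<psi> `` {b}" "c \<in> A" "C = \<psi> `` {c}"
    by (auto elim!: quotientE)
  have b: "b \<in> B" and c: "c \<in> C" using equiv_class_self[OF eq] bc by auto
  have single: "map (\<lambda>j. if j = i then x else b) [0..<m] \<in> \<rho>" if i: "i < m" and x: "x \<in> C" for i x
  proof -
    let ?Bs = "map (\<lambda>j. if j = i then C else B) [0..<m]"
    have "?Bs \<in> nlists m {B, C}" by (rule map_in_nlists) simp
    then have "?Bs \<in> factor_rel \<rho> \<psi>" using BC by blast
    then obtain t where t: "t \<in> \<rho>" "?Bs = map (\<lambda>a. \<psi> `` {a}) t"
      by (auto simp: factor_rel_def)
    have len: "length t = m" using arg_cong[OF t(2), of length] by simp
    have tA: "t ! j \<in> A" if "j < m" for j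
      using t(1) that generalized_quasiorder_subset[OF gq] by (auto simp: in_nlists_iff_nth)
    have t_class: "t ! j \<in> (if j = i then C else B)" if "j < m" for j
      using arg_cong[OF t(2), of "\<lambda>l. l ! j"] that len equiv_class_self[OF eq tA[OF that]]
      by (auto split: if_splits)
    \<comment> \<open>Of the entries of \<open>t\<close> only the classes are known, so
      \<open>c'\<close> is some element of \<open>C\<close>, not necessarily \<open>c\<close> or
      \<open>x\<close>.\<close>
    define c' where "c' = t ! i"
    have c': "c' \<in> C" using t_class[OF i] by (simp add: c'_def)
    have c'_single: "map (\<lambda>j. if j = i then c' else b) [0..<m] \<in> \<rho>"
    proof -
      \<comment> \<open>Row and column \<open>i\<close> are \<open>t\<close>, all else is
        \<open>b\<close>. The other rows have entries in \<open>B\<close> only, and the diagonal is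
        \<open>t\<close> with every entry but \<open>c'\<close> replaced by
        \<open>b\<close>.\<close>
      define M where "M = (\<lambda>k j. if k = i then t ! j else if j = i then t ! k else b)"
      have "map (\<lambda>j. M j j) [0..<m] \<in> \<rho>"
      proof (rule generalized_quasiorder_diag[OF gq, where M = M])
        show "M k j = M j k" for k j by (simp add: M_def)
        fix k assume k: "k < m"
        show "map (M k) [0..<m] \<in> \<rho>"
        proof (cases "k = i")
          case True
          then have "map (M k) [0..<m] = t" using len by (simp add: M_def list_eq_iff_nth_eq)
          then show ?thesis using t by simp
        next
          case False
          then have "map (M k) [0..<m] \<in> nlists m B"
            using b t_class[OF k] by (auto simp: M_def intro!: map_in_nlists)
          then show ?thesis using clique[OF B] by blast
        qed
      qed
      moreover have "map (\<lambda>j. M j j) [0..<m] = map (\<lambda>j. if j = i then c' else b) [0..<m]"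
        by (auto simp: M_def c'_def)
      ultimately show ?thesis by simp
    qed
    \<comment> \<open>Row \<open>i\<close> now consists of \<open>x\<close> and \<open>c'\<close>,
      so it is a tuple over \<open>C\<close>; every other row is the tuple of
      \<open>c'_single\<close>. The diagonal has \<open>x\<close> in place of
      \<open>c'\<close>.\<close>
    define M where "M = (\<lambda>k j. if k = i \<and> j = i then x else if k = i \<or> j = i then c' else b)"
    have "map (\<lambda>j. M j j) [0..<m] \<in> \<rho>"
    proof (rule generalized_quasiorder_diag[OF gq, where M = M])
      show "M k j = M j k" for k j by (auto simp: M_def)
      fix k assume k: "k < m"
      show "map (M k) [0..<m] \<in> \<rho>"
      proof (cases "k = i")
        case True
        then have "map (M k) [0..<m] \<in> nlists m C"
          using x c' by (auto simp: M_def intro!: map_in_nlists)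
        then show ?thesis using clique[OF C] by blast
      next
        case False
        then show ?thesis using c'_single by (simp add: M_def)
      qed
    qed
    moreover have "map (\<lambda>j. M j j) [0..<m] = map (\<lambda>j. if j = i then x else b) [0..<m]"
      by (auto simp: M_def)
    ultimately show ?thesis by simp
  qed
  have "nlists m {b, c} \<subseteq> \<rho>"
  proof (rule nlists_subset_of_single_entries[OF gq])
    fix x i assume "x \<in> {b, c}" "i < m"
    then show "map (\<lambda>j. if j = i then x else b) [0..<m] \<in> \<rho>"
      using single c generalized_quasiorder_replicate[OF gq bc(1)]
      by (auto simp: map_replicate_const cong: if_cong)
  qed
  with bc have "(b, c) \<in> \<psi>" by (auto simp: \<psi>_def square_rel_def)
  with bc show ?thesis using equiv_class_eq[OF eq] by simp
qed

text \<open>Each entry is compared with the first one: all tuples over these two classes are tuples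
  over \<open>set Bs\<close>, so the two classes coincide.\<close>

lemma abs_rel_factor_rel:
  assumes gq: "generalized_quasiorder A m \<rho>" and m: "m \<ge> 1"
  defines "\<psi> \<equiv> square_rel A m \<rho>"
  shows "abs_rel (A // \<psi>) m (factor_rel \<rho> \<psi>) = diagonal (A // \<psi>) m"
proof (intro equalityI subsetI)
  fix Bs assume Bs: "Bs \<in> abs_rel (A // \<psi>) m (factor_rel \<rho> \<psi>)"
  then have len: "length Bs = m" and q: "set Bs \<subseteq> A // \<psi>"
    and sub: "nlists m (set Bs) \<subseteq> factor_rel \<rho> \<psi>"
    by (auto simp: abs_rel_def nlists_def)
  \<comment> \<open>A first entry exists because \<open>m \<ge> 1\<close>.\<close>
  have hd: "hd Bs \<in> set Bs" using len m by (intro hd_in_set) auto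
  have "B = hd Bs" if "B \<in> set Bs" for B
  proof -
    have "nlists m {B, hd Bs} \<subseteq> factor_rel \<rho> \<psi>"
      using sub nlists_mono[of "{B, hd Bs}" "set Bs" m] that hd by blast
    then show ?thesis
      using classes_eq_of_factor_rel[OF gq] q that hd unfolding \<psi>_def by blast
  qed
  then have "Bs = replicate m (hd Bs)" using len by (auto intro: replicate_eqI)
  then show "Bs \<in> diagonal (A // \<psi>) m" using q hd by (auto simp: diagonal_def)
next
  fix Bs assume "Bs \<in> diagonal (A // \<psi>) m"
  then obtain b where b: "b \<in> A" "Bs = replicate m (\<psi> `` {b})"
    by (auto simp: diagonal_def elim!: quotientE)
  have "replicate m (\<psi> `` {b}) \<in> factor_rel \<rho> \<psi>"
    using map_class_in_factor_rel[OF generalized_quasiorder_replicate[OF gq b(1)], of \<psi>] by simp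
  then have "nlists m {\<psi> `` {b}} \<subseteq> factor_rel \<rho> \<psi>" by (simp add: nlists_singleton)
  then show "Bs \<in> abs_rel (A // \<psi>) m (factor_rel \<rho> \<psi>)"
    using b m by (auto simp: abs_rel_def in_nlists_iff_nth quotientI)
qed

text \<open>A tuple over \<open>A\<close> is in \<open>\<rho>\<close> exactly when its tuple of
  classes is in the factor relation. Exchangeability of two classes, tested on the classes of
  \<open>as\<close> and \<open>cs\<close>, therefore descends to their representatives.\<close>

lemma exchangeable_rel_factor_rel:
  assumes gq: "generalized_quasiorder A m \<rho>"
  defines "\<psi> \<equiv> exchangeable_rel A m \<rho>"
  shows "exchangeable_rel (A // \<psi>) m (factor_rel \<rho> \<psi>) = Id_on (A // \<psi>)"
proof -
  have eq: "equiv A \<psi>" unfolding \<psi>_def by (rule equiv_exchangeable_rel)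
  let ?cl = "\<lambda>a. \<psi> `` {a}"
  note iff = map_class_in_factor_rel_exchangeable_iff[OF generalized_quasiorder_subset[OF gq] eq
      eq_refl[OF \<psi>_def[THEN meta_eq_to_obj_eq]]]
  have "B = C" if BC: "(B, C) \<in> exchangeable_rel (A // \<psi>) m (factor_rel \<rho> \<psi>)" for B C
  proof -
    from BC obtain b c where bc: "b \<in> A" "B = ?cl b" "c \<in> A" "C = ?cl c"
      by (auto simp: exchangeable_rel_def[of "A // \<psi>"] elim!: quotientE)
    have "as @ b # cs \<in> \<rho> \<longleftrightarrow> as @ c # cs \<in> \<rho>"
      if "i < m" "as \<in> nlists i A" "cs \<in> nlists (m - 1 - i) A" for i as cs
    proof -
      have "as @ x # cs \<in> nlists m A" if "x \<in> A" for x
        using \<open>i < m\<close> \<open>as \<in> _\<close> \<open>cs \<in> _\<close> that by (auto simp: nlists_def)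
      then have "as @ x # cs \<in> \<rho> \<longleftrightarrow> map ?cl as @ ?cl x # map ?cl cs \<in> factor_rel \<rho> \<psi>"
        if "x \<in> A" for x
        using iff[of "as @ x # cs"] that by simp
      moreover have "map ?cl as @ B # map ?cl cs \<in> factor_rel \<rho> \<psi> \<longleftrightarrow>
          map ?cl as @ C # map ?cl cs \<in> factor_rel \<rho> \<psi>"
        using BC that map_class_in_nlists_quotient
        unfolding exchangeable_rel_def[of "A // \<psi>"] by blast
      ultimately show ?thesis using bc by simp
    qed
    with bc have "(b, c) \<in> \<psi>" by (auto simp: \<psi>_def exchangeable_rel_def)
    with bc show ?thesis using equiv_class_eq[OF eq] by simp
  qed
  then show ?thesis by (auto simp: exchangeable_rel_def[of "A // \<psi>"])
qed

theorem proposition4p5: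
  fixes A :: "'a set" and m :: nat and \<rho> :: "'a list set" and \<psi> :: "('a \<times> 'a) set"
  assumes "finite A" and "A \<noteq> {}" and "m \<ge> 1"
    and "generalized_quasiorder A m \<rho>"
    and "equiv A \<psi>"
  shows "(\<psi> \<subseteq> square_rel A m \<rho> \<longleftrightarrow>
            generalized_quasiorder (A // \<psi>) m (block_factor_rel A m \<rho> \<psi>))
       \<and> (\<psi> \<subseteq> exchangeable_rel A m \<rho> \<longleftrightarrow>
            generalized_quasiorder (A // \<psi>) m (factor_rel \<rho> \<psi>)
            \<and> factor_rel \<rho> \<psi> = block_factor_rel A m \<rho> \<psi>)
       \<and> square_rel (A // square_rel A m \<rho>) m (block_factor_rel A m \<rho> (square_rel A m \<rho>))
            = Id_on (A // square_rel A m \<rho>)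
       \<and> abs_rel (A // square_rel A m \<rho>) m (factor_rel \<rho> (square_rel A m \<rho>))
            = diagonal (A // square_rel A m \<rho>) m
       \<and> exchangeable_rel (A // exchangeable_rel A m \<rho>) m
              (factor_rel \<rho> (exchangeable_rel A m \<rho>))
            = Id_on (A // exchangeable_rel A m \<rho>)"
  using subset_square_rel_iff[OF assms(4,5)] subset_exchangeable_rel_iff[OF assms(4,5)]
    square_rel_block_factor_rel[OF assms(4)] abs_rel_factor_rel[OF assms(4,3)]
    exchangeable_rel_factor_rel[OF assms(4)]
  by blast

end
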